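(* Let $\mu>0$. Suppose that $f:\mathbb{R}^d\to\mathbb{R}$ is $\mu$-strongly convex and twice continuously differentiable with minimizer $x^*$, that $f$ satisfies either the global or the local generalized Hessian smoothness condition (with constants $M_0,M_1\ge0$, and radius $\rho>0$ in the local case), and that for some $\nu>0$ the symmetric Hessian approximations satisfy $$\delta_k:=\|H(x_k)-\nabla^2f(x_k)\|\le\nu\|\nabla f(x_k)\|,\qquad k\ge0,$$ along the iterates of the adaptive regularized Newton method started from $x_0$ with $\eta_0>0$. Let $r_0=\min\{\rho/2,\,1/(6\sqrt{M_1})\}$. Then: (i) The method converges globally superlinearly in function value, and every completed iteration $k$ satisfies $$\tau_k\le\max\left\{\frac{2^{-k}\eta_0}{\|\nabla f(x_0)\|},\ \frac{24M_0}{\mu}+8\nu,\ \frac{2}{r_0}\right\}\|\nabla f(x_k)\|,$$ $$f(x_{k+1})-f^*\le\left(1-\frac{2\mu}{3\tau_k+2\mu}\right)^2\big(f(x_k)-f^*\big).$$ (ii) Let $C=\frac{9(\|\nabla^2f(x^* )\|+\mu)}{2\mu^2}\left(8\nu+\frac{24M_0}{\mu}\right)^2$ and suppose that for some $K_0\ge1$, $f(x_{K_0})-f^*\le\min\{\mu r_0^2/8,\ 1/(2C)\}$. Then, after finitely many additional iterations whose number is independent of the target accuracy, the method converges quadratically: there is $K\ge K_0$ such that $$f(x_{k+1})-f^*\le C\big(f(x_k)-f^*\big)^2,\qquad k\ge K.$$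
   Context: $\|\cdot\|$ is the Euclidean norm for vectors and the induced operator norm for matrices; $f^*=f(x^* )$. Conventions: $a/(+\infty)=0$ for finite $a\ge0$, and $1/\sqrt{M_1}=+\infty$ if $M_1=0$. Strong convexity: $f(y)\ge f(x)+\langle\nabla f(x),y-x\rangle+\frac\mu2\|y-x\|^2$ for all $x,y$. Put $L(x)=M_0+M_1\|\nabla f(x)\|$. Global generalized Hessian smoothness: $\|\nabla^2f(y)-\nabla^2f(x)\|\le L(x)\|y-x\|$ for all $x,y\in\mathbb{R}^d$; in this case set $\rho=+\infty$. Local generalized Hessian smoothness with radius $\rho>0$: the same inequality for all $x,y$ with $\|y-x\|\le\rho$. Procedure $\mathrm{MSBacktrack}(x,\tau)$ (for $x\in\mathbb{R}^d$, $\tau>0$): repeat the following trial. If $H(x)+\tau I\succ0$, solve $(H(x)+\tau I)s=-\nabla f(x)$; if moreover $\|\nabla f(x+s)+\tau s\|\le\frac{\tau}{2}\|s\|$, return the pair $(x+s,\tau)$. Otherwise (trial rejected) replace $\tau$ by $2\tau$. Adaptive regularized Newton method. Input $x_0\in\mathbb{R}^d$, $\eta_0>0$. For $k\ge0$: $(x_{k+1},\tau_k)=\mathrm{MSBacktrack}(x_k,\eta_k)$ and $\eta_{k+1}=\frac{\tau_k}{2}\min\big\{1,\frac{\|\nabla f(x_{k+1})\|}{\|\nabla f(x_k)\|}\big\}$. If $\nabla f(x_k)=0$ the method stops and returns the minimizer $x_k$; completed iterations are those carried out before such a stop, and all claims are about completed iterations. "Converges globally superlinearly" means: from every $x_0$,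 either a minimizer is returned after finitely many iterations or $\frac{f(x_{k+1})-f^*}{f(x_k)-f^*}\to0$. *)

theory Defs
  imports "HOL-Analysis.Analysis"
begin

definition grad :: "('a::real_inner \<Rightarrow> real) \<Rightarrow> 'a \<Rightarrow> 'a" where
  "grad f x = (THE g. GDERIV f x :> g)"

definition hess :: "(real^'n \<Rightarrow> real) \<Rightarrow> real^'n \<Rightarrow> real^'n^'n" where
  "hess f x = jacobian (grad f) (at x)"

definition twice_continuously_differentiable :: "(real^'n \<Rightarrow> real) \<Rightarrow> bool" where
  "twice_continuously_differentiable f \<longleftrightarrow>
     (\<forall>x. f differentiable (at x)) \<and> (\<forall>x. grad f differentiable (at x)) \<and>
     continuous_on UNIV (hess f)"

(* The instance of norm on real^'n^'n is the Frobenius norm, hence a separate constant. *)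
definition opnorm :: "real^'n^'m \<Rightarrow> real" where
  "opnorm A = onorm ((*v) A)"

definition positive_definite :: "real^'n^'n \<Rightarrow> bool" where
  "positive_definite A \<longleftrightarrow> transpose A = A \<and> (\<forall>v. v \<noteq> 0 \<longrightarrow> v \<bullet> (A *v v) > 0)"

definition strongly_convex :: "real \<Rightarrow> ('a::real_inner \<Rightarrow> real) \<Rightarrow> bool" where
  "strongly_convex \<mu> f \<longleftrightarrow>
     (\<forall>x y. f y \<ge> f x + grad f x \<bullet> (y - x) + \<mu> / 2 * (norm (y - x))\<^sup>2)"

definition global_hessian_smooth :: "real \<Rightarrow> real \<Rightarrow> (real^'n \<Rightarrow> real) \<Rightarrow> bool" where
  "global_hessian_smooth M0 M1 f \<longleftrightarrow>
     (\<forall>x y. opnorm (hess f y - hess f x) \<le> (M0 + M1 * norm (grad f x)) * norm (y - x))"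

definition local_hessian_smooth :: "real \<Rightarrow> real \<Rightarrow> real \<Rightarrow> (real^'n \<Rightarrow> real) \<Rightarrow> bool" where
  "local_hessian_smooth r M0 M1 f \<longleftrightarrow>
     (\<forall>x y. norm (y - x) \<le> r \<longrightarrow>
        opnorm (hess f y - hess f x) \<le> (M0 + M1 * norm (grad f x)) * norm (y - x))"

(* The value is None exactly when every trial is rejected, i.e. the procedure does not terminate.
   The description operator is only used when the linear system has a unique solution. *)
partial_function (option) ms_backtrack ::
  "(real^'n \<Rightarrow> real) \<Rightarrow> (real^'n \<Rightarrow> real^'n^'n) \<Rightarrow> real^'n \<Rightarrow> real \<Rightarrow> ((real^'n) \<times> real) option" where
  "ms_backtrack f H x \<tau> =
     (let A = H x + mat \<tau>; s = (THE s. A *v s = - grad f x) in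
      if positive_definite A \<and> norm (grad f (x + s) + \<tau> *\<^sub>R s) \<le> \<tau> / 2 * norm s
      then Some (x + s, \<tau>)
      else ms_backtrack f H x (2 * \<tau>))"

(* Adaptive regularized Newton method: arn_state f H x0 eta0 k is the pair (x_k, eta_k), or None if x_k is never computed, because
   the method stopped at an earlier iterate or because an earlier call of ms_backtrack diverged. *)
primrec arn_state ::
  "(real^'n \<Rightarrow> real) \<Rightarrow> (real^'n \<Rightarrow> real^'n^'n) \<Rightarrow> real^'n \<Rightarrow> real \<Rightarrow> nat \<Rightarrow> ((real^'n) \<times> real) option" where
  "arn_state f H x0 \<eta>0 0 = Some (x0, \<eta>0)"
| "arn_state f H x0 \<eta>0 (Suc k) =
     (case arn_state f H x0 \<eta>0 k of
        None \<Rightarrow> None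
      | Some (x, \<eta>) \<Rightarrow>
          if grad f x = 0 then None
          else (case ms_backtrack f H x \<eta> of
                  None \<Rightarrow> None
                | Some (x', \<tau>) \<Rightarrow>
                    Some (x', \<tau> / 2 * min 1 (norm (grad f x') / norm (grad f x)))))"

definition arn_reached ::
  "(real^'n \<Rightarrow> real) \<Rightarrow> (real^'n \<Rightarrow> real^'n^'n) \<Rightarrow> real^'n \<Rightarrow> real \<Rightarrow> nat \<Rightarrow> bool" where
  "arn_reached f H x0 \<eta>0 k \<longleftrightarrow> arn_state f H x0 \<eta>0 k \<noteq> None"

definition arn_completed ::
  "(real^'n \<Rightarrow> real) \<Rightarrow> (real^'n \<Rightarrow> real^'n^'n) \<Rightarrow> real^'n \<Rightarrow> real \<Rightarrow> nat \<Rightarrow> bool" where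
  "arn_completed f H x0 \<eta>0 k \<longleftrightarrow> arn_reached f H x0 \<eta>0 (Suc k)"

(* x_k is meaningful if arn_reached holds at k, tau_k if arn_completed holds at k. *)
definition arn_x ::
  "(real^'n \<Rightarrow> real) \<Rightarrow> (real^'n \<Rightarrow> real^'n^'n) \<Rightarrow> real^'n \<Rightarrow> real \<Rightarrow> nat \<Rightarrow> real^'n" where
  "arn_x f H x0 \<eta>0 k = fst (the (arn_state f H x0 \<eta>0 k))"

definition arn_tau ::
  "(real^'n \<Rightarrow> real) \<Rightarrow> (real^'n \<Rightarrow> real^'n^'n) \<Rightarrow> real^'n \<Rightarrow> real \<Rightarrow> nat \<Rightarrow> real" where
  "arn_tau f H x0 \<eta>0 k =
     (case the (arn_state f H x0 \<eta>0 k) of (x, \<eta>) \<Rightarrow> snd (the (ms_backtrack f H x \<eta>)))"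

(* In ereal, a / \<infinity> = 0 for real a and 1 / 0 = \<infinity>, so the conventions
   for rho = \<infinity> and M1 = 0 are built in. *)
definition arn_radius :: "ereal \<Rightarrow> real \<Rightarrow> ereal" where
  "arn_radius \<rho> M1 = min (\<rho> / 2) (1 / (6 * ereal (sqrt M1)))"

end

theory Submission
  imports Defs
begin

text \<open>The proof rests on one observation about a single trial. If the Hessian error at \<open>x\<close> is at most
\<open>\<tau>/4\<close>, then the shifted matrix \<open>H x + \<tau> I\<close> dominates \<open>(\<mu> + 3\<tau>/4) I\<close>, so the step satisfies
\<open>\<parallel>s\<parallel> \<le> \<parallel>\<nabla>f x\<parallel> / (\<mu> + 3\<tau>/4)\<close>. The residual \<open>\<nabla>f (x + s) + \<tau> s\<close> is the Taylor remainder of the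
gradient, at most \<open>L(x) \<parallel>s\<parallel>\<^sup>2 / 2\<close>, minus the matrix error applied to \<open>s\<close>. Both are small compared
with \<open>\<tau> \<parallel>s\<parallel>\<close> once \<open>\<tau>\<close> is a large enough multiple of \<open>\<parallel>\<nabla>f x\<parallel>\<close> (\<open>acceptedI\<close>). Hence there is a
constant \<open>B\<close>, the same for all iterates, such that every trial with \<open>2\<tau> \<ge> B \<parallel>\<nabla>f x\<parallel>\<close> is accepted
(\<open>accepted_global\<close>). Since trials are doubled, the returned value is at most
\<open>max \<eta>\<^sub>k (B \<parallel>\<nabla>f x\<^sub>k\<parallel>)\<close>. The update of \<open>\<eta>\<close> halves the quotient \<open>\<tau>\<^sub>k / \<parallel>\<nabla>f x\<^sub>k\<parallel>\<close> at each iteration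
until the level \<open>B\<close> is reached, which gives the bound on \<open>\<tau>\<^sub>k\<close> (\<open>eta_tau_halving\<close>, \<open>tau_le\<close>).

An accepted step is an inexact proximal point step, \<open>\<nabla>f (x + s) \<approx> - \<tau> s\<close> with relative error one
half. Strong convexity at the new point turns this into the contraction of the function gap
(\<open>gap_contraction_of_residual\<close>). The iterates stay in a bounded sublevel set, so \<open>\<tau>\<^sub>k\<close> is bounded and
the gap tends to zero linearly. Then the gradients, and with them \<open>\<tau>\<^sub>k\<close> and the contraction factors,
tend to zero, and this is superlinear convergence (\<open>iterates_converge\<close>, \<open>superlinear\<close>).

Near the minimizer \<open>\<parallel>s\<parallel> \<le> \<parallel>\<nabla>f x\<parallel> / \<mu>\<close> is so small that the radius \<open>\<rho>\<close> no longer restricts the step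
and the \<open>M1\<close>-term is absorbed by the \<open>\<nu>\<close>-term. There the constant \<open>B\<close> may be replaced by
\<open>\<beta> = 24 M0 / \<mu> + 8 \<nu>\<close> (\<open>accepted_local\<close>), and a second run of the halving argument shows
\<open>\<tau>\<^sub>k \<le> \<beta> \<parallel>\<nabla>f x\<^sub>k\<parallel>\<close> eventually. The contraction factor is at most \<open>(3\<tau>\<^sub>k / 2\<mu>)\<^sup>2\<close>, and
\<open>\<parallel>\<nabla>f x\<parallel>\<^sup>2 \<le> 2 (\<parallel>\<nabla>\<^sup>2f x\<^sup>*\<parallel> + \<mu>) (f x - f x\<^sup>*)\<close> near \<open>x\<^sup>*\<close> (\<open>eventually_grad_sq_le_f_gap\<close>), so the factor is
bounded by \<open>C\<close> times the gap (\<open>eventually_quadratic\<close>).\<close>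

section \<open>Gradients and Hessians along segments\<close>

text \<open>The gradient vector is assembled from the values of the derivative on the basis; uniqueness of
derivatives makes the description operator pick it.\<close>

lemma gderiv_grad:
  fixes f :: "'a::euclidean_space \<Rightarrow> real"
  assumes "f differentiable (at x)"
  shows "GDERIV f x :> grad f x"
proof -
  obtain f' where f': "(f has_derivative f') (at x)"
    using assms by (auto simp: differentiable_def)
  define g where "g = (\<Sum>b\<in>Basis. f' b *\<^sub>R b)"
  have "f' h = h \<bullet> g" for h
  proof -
    have lin: "linear f'"
      using f' has_derivative_linear by blast
    have "f' h = f' (\<Sum>b\<in>Basis. (h \<bullet> b) *\<^sub>R b)"
      by (simp add: euclidean_representation)
    also have "\<dots> = (\<Sum>b\<in>Basis. (h \<bullet> b) * f' b)"
      by (simp add: linear_sum[OF lin] linear_scale[OF lin])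
    also have "\<dots> = h \<bullet> g"
      by (simp add: g_def inner_sum_right mult.commute)
    finally show ?thesis .
  qed
  then have g: "GDERIV f x :> g"
    using f' unfolding gderiv_def by (metis ext)
  have "g' = g" if "GDERIV f x :> g'" for g'
  proof -
    have "(\<lambda>h. h \<bullet> g') = (\<lambda>h. h \<bullet> g)"
      using that g unfolding gderiv_def by (rule has_derivative_unique)
    then show ?thesis
      by (metis inner_commute vector_eq_rdot)
  qed
  with g show ?thesis
    unfolding grad_def by (metis theI)
qed

lemma norm_mult_le_opnorm: "norm (A *v v) \<le> opnorm A * norm v"
  unfolding opnorm_def by (rule onorm) simp

lemma opnorm_nonneg: "0 \<le> opnorm A"
  unfolding opnorm_def by (rule onorm_pos_le) simp

text \<open>Both Taylor estimates below, for the gradient and for the function, reduce to this scalar bound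
along a segment.\<close>

lemma increment_le_of_deriv_le:
  fixes \<phi> \<phi>' :: "real \<Rightarrow> real"
  assumes "\<And>t. 0 \<le> t \<Longrightarrow> t \<le> 1 \<Longrightarrow> (\<phi> has_real_derivative \<phi>' t) (at t)"
    and "\<And>t. 0 \<le> t \<Longrightarrow> t \<le> 1 \<Longrightarrow> \<phi>' t \<le> a + c * t"
  shows "\<phi> 1 - \<phi> 0 \<le> a + c / 2"
proof -
  let ?\<psi> = "\<lambda>t. \<phi> t - (a * t + c * t\<^sup>2 / 2)"
  have "?\<psi> 1 \<le> ?\<psi> 0"
  proof (rule DERIV_nonpos_imp_nonincreasing[where f = ?\<psi> and a = 0 and b = 1])
    fix t :: real assume t: "0 \<le> t" "t \<le> 1"
    have "(?\<psi> has_real_derivative \<phi>' t - (a + c * t)) (at t)"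
      using assms(1)[OF t] by (auto intro!: derivative_eq_intros)
    moreover have "\<phi>' t - (a + c * t) \<le> 0"
      using assms(2)[OF t] by simp
    ultimately show "\<exists>y. (?\<psi> has_real_derivative y) (at t) \<and> y \<le> 0"
      by blast
  qed simp
  then show ?thesis by simp
qed

locale strongly_convex_C2 =
  fixes f :: "real^'d \<Rightarrow> real" and \<mu> :: real
  assumes mu_pos: "\<mu> > 0"
    and C2: "twice_continuously_differentiable f"
    and strongly_convex: "strongly_convex \<mu> f"
begin

lemma has_derivative_f: "(f has_derivative (\<lambda>h. h \<bullet> grad f x)) (at x)"
  using gderiv_grad[of f x] C2
  unfolding twice_continuously_differentiable_def gderiv_def by blast

lemma has_derivative_grad: "(grad f has_derivative (\<lambda>h. hess f x *v h)) (at x)"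
  using C2 jacobian_works[of "grad f" "at x"]
  unfolding twice_continuously_differentiable_def hess_def by blast

lemma isCont_grad: "isCont (grad f) x"
  using has_derivative_grad has_derivative_continuous by blast

lemma deriv_f_segment:
  "((\<lambda>t. f (x + t *\<^sub>R v)) has_real_derivative v \<bullet> grad f (x + t *\<^sub>R v)) (at t)"
proof -
  have "((\<lambda>t. f (x + t *\<^sub>R v)) has_derivative (\<lambda>h. (h *\<^sub>R v) \<bullet> grad f (x + t *\<^sub>R v))) (at t)"
    by (rule has_derivative_compose[OF _ has_derivative_f]) (auto intro!: derivative_eq_intros)
  then show ?thesis
    by (simp add: has_field_derivative_def mult_commute_abs)
qed

lemma deriv_grad_segment:
  "((\<lambda>t. w \<bullet> grad f (x + t *\<^sub>R v)) has_real_derivative w \<bullet> (hess f (x + t *\<^sub>R v) *v v)) (at t)"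
proof -
  have "((\<lambda>t. grad f (x + t *\<^sub>R v)) has_derivative (\<lambda>h. hess f (x + t *\<^sub>R v) *v (h *\<^sub>R v))) (at t)"
    by (rule has_derivative_compose[OF _ has_derivative_grad]) (auto intro!: derivative_eq_intros)
  then have "((\<lambda>t. w \<bullet> grad f (x + t *\<^sub>R v)) has_derivative
      (\<lambda>h. w \<bullet> (hess f (x + t *\<^sub>R v) *v (h *\<^sub>R v)))) (at t)"
    by (rule has_derivative_inner_right)
  then show ?thesis
    by (simp add: has_field_derivative_def matrix_vector_mult_scaleR mult_commute_abs)
qed

text \<open>The vector-valued remainder \<open>u\<close> is reduced to a scalar function by pairing with \<open>u\<close> itself: the
increment of the paired function is \<open>\<parallel>u\<parallel>\<^sup>2\<close>, and one factor \<open>\<parallel>u\<parallel>\<close> cancels.\<close>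

lemma grad_taylor_bound:
  assumes "\<And>t. 0 \<le> t \<Longrightarrow> t \<le> 1 \<Longrightarrow> opnorm (hess f (x + t *\<^sub>R s) - hess f x) \<le> L * (t * norm s)"
  shows "norm (grad f (x + s) - grad f x - hess f x *v s) \<le> L / 2 * (norm s)\<^sup>2"
proof -
  define u where "u = grad f (x + s) - grad f x - hess f x *v s"
  let ?\<phi> = "\<lambda>t. u \<bullet> grad f (x + t *\<^sub>R s) - t * (u \<bullet> (hess f x *v s))"
  have "?\<phi> 1 - ?\<phi> 0 \<le> 0 + (norm u * L * (norm s)\<^sup>2) / 2"
  proof (rule increment_le_of_deriv_le)
    fix t :: real assume t: "0 \<le> t" "t \<le> 1"
    show "(?\<phi> has_real_derivative u \<bullet> (hess f (x + t *\<^sub>R s) *v s) - u \<bullet> (hess f x *v s)) (at t)"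
      by (rule derivative_eq_intros deriv_grad_segment | simp)+
    have "u \<bullet> (hess f (x + t *\<^sub>R s) *v s) - u \<bullet> (hess f x *v s)
        = u \<bullet> ((hess f (x + t *\<^sub>R s) - hess f x) *v s)"
      by (simp add: matrix_vector_mult_diff_rdistrib inner_diff_right)
    also have "\<dots> \<le> norm u * norm ((hess f (x + t *\<^sub>R s) - hess f x) *v s)"
      by (rule norm_cauchy_schwarz)
    also have "\<dots> \<le> norm u * (opnorm (hess f (x + t *\<^sub>R s) - hess f x) * norm s)"
      by (intro mult_left_mono norm_mult_le_opnorm norm_ge_zero)
    also have "\<dots> \<le> norm u * ((L * (t * norm s)) * norm s)"
      by (intro mult_left_mono mult_right_mono assms t norm_ge_zero)
    finally show "u \<bullet> (hess f (x + t *\<^sub>R s) *v s) - u \<bullet> (hess f x *v s)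
        \<le> 0 + norm u * L * (norm s)\<^sup>2 * t"
      by (simp add: power2_eq_square mult_ac)
  qed
  moreover have "?\<phi> 1 - ?\<phi> 0 = norm u * norm u"
    by (simp only: u_def power2_norm_eq_inner flip: power2_eq_square)
       (simp add: inner_diff_right)
  ultimately have "norm u * norm u \<le> norm u * (L / 2 * (norm s)\<^sup>2)"
    by simp
  moreover have "0 \<le> L / 2 * (norm s)\<^sup>2"
    using mult_right_mono[OF order_trans[OF opnorm_nonneg assms[of 1]], of "norm s"]
    by (simp add: power2_eq_square mult_ac)
  ultimately show ?thesis
    unfolding u_def[symmetric]
    by (cases "norm u = 0") (auto simp: mult_le_cancel_left)
qed

lemma descent_lemma:
  assumes "\<And>t. 0 \<le> t \<Longrightarrow> t \<le> 1 \<Longrightarrow> norm (grad f (x + t *\<^sub>R s) - grad f x) \<le> L * (t * norm s)"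
  shows "f (x + s) \<le> f x + s \<bullet> grad f x + L / 2 * (norm s)\<^sup>2"
proof -
  let ?\<phi> = "\<lambda>t. f (x + t *\<^sub>R s)"
  have "?\<phi> 1 - ?\<phi> 0 \<le> s \<bullet> grad f x + (L * (norm s)\<^sup>2) / 2"
  proof (rule increment_le_of_deriv_le)
    fix t :: real assume t: "0 \<le> t" "t \<le> 1"
    show "(?\<phi> has_real_derivative s \<bullet> grad f (x + t *\<^sub>R s)) (at t)"
      by (rule deriv_f_segment)
    have "s \<bullet> (grad f (x + t *\<^sub>R s) - grad f x) \<le> norm s * norm (grad f (x + t *\<^sub>R s) - grad f x)"
      by (rule norm_cauchy_schwarz)
    also have "\<dots> \<le> norm s * (L * (t * norm s))"
      by (intro mult_left_mono assms t norm_ge_zero)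
    finally show "s \<bullet> grad f (x + t *\<^sub>R s) \<le> s \<bullet> grad f x + L * (norm s)\<^sup>2 * t"
      by (simp add: power2_eq_square mult_ac inner_diff_right)
  qed
  then show ?thesis by simp
qed

lemma strong_convexity_ineq: "f x + grad f x \<bullet> (y - x) + \<mu> / 2 * (norm (y - x))\<^sup>2 \<le> f y"
  using strongly_convex unfolding strongly_convex_def by blast

text \<open>Strong convexity, used in both directions between two points of a line, says that
\<open>t \<mapsto> v \<bullet> \<nabla>f (x + t v) - \<mu> \<parallel>v\<parallel>\<^sup>2 t\<close> is monotone, so its derivative at zero is nonnegative.\<close>

lemma hess_ge: "\<mu> * (norm v)\<^sup>2 \<le> v \<bullet> (hess f x *v v)"
proof -
  let ?\<phi> = "\<lambda>t. v \<bullet> grad f (x + t *\<^sub>R v) - \<mu> * (norm v)\<^sup>2 * t"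
  have "mono ?\<phi>"
  proof (rule monoI)
    fix r t :: real assume "r \<le> t"
    let ?a = "x + r *\<^sub>R v" and ?b = "x + t *\<^sub>R v"
    have d: "?b - ?a = (t - r) *\<^sub>R v" "?a - ?b = (r - t) *\<^sub>R v"
      by (simp_all add: algebra_simps)
    have "0 \<le> (t - r) * (?\<phi> t - ?\<phi> r)"
      using strong_convexity_ineq[of ?a ?b] strong_convexity_ineq[of ?b ?a]
      unfolding d by (simp add: power_mult_distrib inner_commute norm_minus_commute) (simp add: field_simps power2_eq_square)
    then show "?\<phi> r \<le> ?\<phi> t"
      using \<open>r \<le> t\<close> by (cases "r = t") (auto simp: zero_le_mult_iff)
  qed
  moreover have "(?\<phi> has_real_derivative v \<bullet> (hess f (x + 0 *\<^sub>R v) *v v) - \<mu> * (norm v)\<^sup>2) (at 0)"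
    by (rule derivative_eq_intros deriv_grad_segment | simp)+
  ultimately have "v \<bullet> (hess f (x + 0 *\<^sub>R v) *v v) - \<mu> * (norm v)\<^sup>2 \<ge> 0"
    by (intro mono_on_imp_deriv_nonneg[of UNIV ?\<phi>]) auto
  then show ?thesis by simp
qed

text \<open>The quadratic lower bound in the definition of strong convexity is minimized over \<open>y\<close> by completing
the square.\<close>

lemma f_gap_le_grad: "2 * \<mu> * (f x - f y) \<le> (norm (grad f x))\<^sup>2"
proof -
  have "0 \<le> (norm (grad f x + \<mu> *\<^sub>R (y - x)))\<^sup>2" by simp
  also have "\<dots> = (norm (grad f x))\<^sup>2 + 2 * \<mu> * (grad f x \<bullet> (y - x)) + \<mu>\<^sup>2 * (norm (y - x))\<^sup>2"
    by (simp only: power2_norm_eq_inner) (simp add: inner_add_left inner_add_right inner_commute power2_eq_square algebra_simps)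
  finally show ?thesis
    using mult_left_mono[OF strong_convexity_ineq[of x y], of "2 * \<mu>"] mu_pos
    by (simp add: algebra_simps power2_eq_square)
qed

lemma minimizer_of_grad_zero: "grad f x = 0 \<Longrightarrow> f x \<le> f y"
  using f_gap_le_grad[of x y] mu_pos by (simp add: mult_le_0_iff)

lemma grad_minimizer:
  assumes "\<forall>y. f z \<le> f y"
  shows "grad f z = 0"
proof -
  have "(\<lambda>h. h \<bullet> grad f z) = (\<lambda>h. 0)"
    by (rule differential_zero_maxmin[OF _ open_UNIV has_derivative_f]) (use assms in auto)
  then show ?thesis
    by (metis inner_eq_zero_iff)
qed

lemma dist_minimizer_le:
  assumes "\<forall>y. f z \<le> f y"
  shows "\<mu> / 2 * (norm (x - z))\<^sup>2 \<le> f x - f z"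
  using strong_convexity_ineq[of z x] grad_minimizer[OF assms] by simp

text \<open>Continuity of the Hessian is given for the Frobenius norm; the sum of the absolute entries bounds
the operator norm and is continuous as well.\<close>

lemma eventually_opnorm_hess_le:
  assumes "\<epsilon> > 0"
  shows "\<forall>\<^sub>F y in nhds z. opnorm (hess f y) \<le> opnorm (hess f z) + \<epsilon>"
proof -
  have "isCont (hess f) z"
    using C2 unfolding twice_continuously_differentiable_def by (simp add: continuous_on_eq_continuous_at)
  then have "(hess f \<longlongrightarrow> hess f z) (nhds z)"
    by (simp add: continuous_at tendsto_at_iff_tendsto_nhds)
  then have "((\<lambda>y. \<Sum>i\<in>UNIV. \<Sum>j\<in>UNIV. \<bar>hess f y $ i $ j - hess f z $ i $ j\<bar>) \<longlongrightarrow>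
      (\<Sum>i\<in>UNIV. \<Sum>j\<in>UNIV. \<bar>hess f z $ i $ j - hess f z $ i $ j\<bar>)) (nhds z)"
    by (intro tendsto_intros)
  then have "\<forall>\<^sub>F y in nhds z. (\<Sum>i\<in>UNIV. \<Sum>j\<in>UNIV. \<bar>hess f y $ i $ j - hess f z $ i $ j\<bar>) < \<epsilon>"
    using assms by (auto intro!: order_tendstoD(2))
  then show ?thesis
  proof (rule eventually_mono)
    fix y assume y: "(\<Sum>i\<in>UNIV. \<Sum>j\<in>UNIV. \<bar>hess f y $ i $ j - hess f z $ i $ j\<bar>) < \<epsilon>"
    have "opnorm (hess f y) = onorm (\<lambda>v. hess f z *v v + (hess f y - hess f z) *v v)"
      by (simp add: opnorm_def matrix_vector_mult_diff_rdistrib)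
    also have "\<dots> \<le> opnorm (hess f z) + opnorm (hess f y - hess f z)"
      unfolding opnorm_def by (rule onorm_triangle) simp_all
    also have "opnorm (hess f y - hess f z) \<le> \<epsilon>"
      using onorm_le_matrix_component_sum[of "hess f y - hess f z"] y unfolding opnorm_def by simp
    finally show "opnorm (hess f y) \<le> opnorm (hess f z) + \<epsilon>" by simp
  qed
qed

text \<open>Near \<open>z\<close> the gradient is Lipschitz with constant \<open>L = \<parallel>\<nabla>\<^sup>2f z\<parallel> + \<mu>\<close>, where the summand \<open>\<mu>\<close> leaves room
for the variation of the Hessian. One gradient step with step size \<open>1/L\<close> from \<open>y\<close> lowers \<open>f\<close> by at
least \<open>\<parallel>\<nabla>f y\<parallel>\<^sup>2 / (2L)\<close>, and it cannot go below the minimum. The point \<open>y\<close> is taken so close to \<open>z\<close>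
that the whole step remains in the ball of validity.\<close>

lemma eventually_grad_sq_le_f_gap:
  assumes min: "\<forall>y. f z \<le> f y"
  shows "\<forall>\<^sub>F y in nhds z. (norm (grad f y))\<^sup>2 \<le> 2 * (opnorm (hess f z) + \<mu>) * (f y - f z)"
proof -
  define L where "L = opnorm (hess f z) + \<mu>"
  have L: "L > 0" using opnorm_nonneg[of "hess f z"] mu_pos by (simp add: L_def)
  obtain r where r: "r > 0" "\<And>y. dist y z < r \<Longrightarrow> opnorm (hess f y) \<le> L"
    using eventually_opnorm_hess_le[OF mu_pos, of z] unfolding eventually_nhds_metric L_def by blast
  have lip: "norm (grad f y - grad f w) \<le> L * norm (y - w)" if "y \<in> ball z r" "w \<in> ball z r" for y w
    using that r(2)
    by (intro differentiable_bound[OF convex_ball[of z r], where f' = "\<lambda>y h. hess f y *v h"])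
       (auto simp: dist_commute opnorm_def intro: has_derivative_at_withinI has_derivative_grad)
  have "isCont (\<lambda>y. norm (grad f y)) z"
    using isCont_grad by (rule isCont_norm)
  then have "((\<lambda>y. norm (grad f y)) \<longlongrightarrow> norm (grad f z)) (nhds z)"
    unfolding continuous_at by (subst (asm) tendsto_at_iff_tendsto_nhds)
  then have "((\<lambda>y. norm (grad f y)) \<longlongrightarrow> 0) (nhds z)"
    by (simp add: grad_minimizer[OF min])
  then have "\<forall>\<^sub>F y in nhds z. norm (grad f y) < L * (r / 2)"
    by (rule order_tendstoD(2)) (use L r(1) in simp)
  moreover have "\<forall>\<^sub>F y in nhds z. dist y z < r / 2"
    unfolding eventually_nhds_metric using r(1) half_gt_zero by blast
  ultimately show ?thesis
  proof eventually_elim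
    case (elim y)
    define s where "s = - (1 / L) *\<^sub>R grad f y"
    have ns: "norm s = norm (grad f y) / L" using L by (simp add: s_def)
    then have "norm s < r / 2" using elim(1) L unfolding ns by (simp add: pos_divide_less_eq mult.commute)
    then have inball: "y + t *\<^sub>R s \<in> ball z r" if "0 \<le> t" "t \<le> 1" for t
    proof -
      have "norm (t *\<^sub>R s) \<le> norm s" using that by (simp add: mult_left_le_one_le)
      moreover have "dist z (y + t *\<^sub>R s) \<le> dist y z + norm (t *\<^sub>R s)"
        using norm_triangle_ineq4[of "z - y" "t *\<^sub>R s"]
        by (simp add: dist_norm norm_minus_commute algebra_simps)
      ultimately show ?thesis using elim(2) \<open>norm s < r / 2\<close> by simp
    qed
    have "f (y + s) \<le> f y + s \<bullet> grad f y + L / 2 * (norm s)\<^sup>2"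
    proof (rule descent_lemma)
      fix t :: real assume t: "0 \<le> t" "t \<le> 1"
      show "norm (grad f (y + t *\<^sub>R s) - grad f y) \<le> L * (t * norm s)"
        using lip[OF inball[OF t] inball[of 0]] t by simp
    qed
    moreover have "s \<bullet> grad f y = - (norm (grad f y))\<^sup>2 / L"
      by (simp add: s_def power2_norm_eq_inner)
    moreover have "L / 2 * (norm s)\<^sup>2 = (norm (grad f y))\<^sup>2 / L / 2"
      using L by (simp add: ns power2_eq_square)
    ultimately have "(norm (grad f y))\<^sup>2 / L / 2 \<le> f y - f (y + s)"
      by simp
    also have "\<dots> \<le> f y - f z" using min by simp
    finally show ?case
      using L unfolding L_def[symmetric] by (simp add: pos_divide_le_eq mult_ac)
  qed
qed

end

section \<open>Regularized Newton steps\<close>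

definition newton_step :: "(real^'n \<Rightarrow> real) \<Rightarrow> (real^'n \<Rightarrow> real^'n^'n) \<Rightarrow> real^'n \<Rightarrow> real \<Rightarrow> real^'n" where
  "newton_step f H x \<tau> = (THE s. (H x + mat \<tau>) *v s = - grad f x)"

definition accepted :: "(real^'n \<Rightarrow> real) \<Rightarrow> (real^'n \<Rightarrow> real^'n^'n) \<Rightarrow> real^'n \<Rightarrow> real \<Rightarrow> bool" where
  "accepted f H x \<tau> \<longleftrightarrow> positive_definite (H x + mat \<tau>) \<and>
     norm (grad f (x + newton_step f H x \<tau>) + \<tau> *\<^sub>R newton_step f H x \<tau>)
       \<le> \<tau> / 2 * norm (newton_step f H x \<tau>)"

lemma mat_mult_vec: "mat (c::real) *v v = c *\<^sub>R v"
  by (simp add: vec_eq_iff mat_def matrix_vector_mult_def if_distrib[where f = "\<lambda>u. u * _"] cong: if_cong)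

lemma positive_definite_solve:
  assumes "positive_definite A"
  shows "A *v (THE s. A *v s = b) = b"
proof -
  have "\<forall>v. A *v v = 0 \<longrightarrow> v = 0"
    using assms unfolding positive_definite_def by (metis inner_zero_right less_irrefl)
  then have "invertible A"
    by (simp add: invertible_left_inverse matrix_left_invertible_ker)
  then have "bij ((*v) A)"
    by (simp add: invertible_eq_bij)
  then have "\<exists>!s. A *v s = b"
    by (simp add: bij_iff)
  then show ?thesis
    by (rule theI')
qed

lemma newton_step_eq:
  assumes "positive_definite (H x + mat \<tau>)"
  shows "H x *v newton_step f H x \<tau> = - grad f x - \<tau> *\<^sub>R newton_step f H x \<tau>"
  using positive_definite_solve[OF assms, of "- grad f x"]
  unfolding newton_step_def[symmetric]
  by (simp add: matrix_vector_mult_add_rdistrib mat_mult_vec algebra_simps)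

lemma ms_backtrack_rec:
  "ms_backtrack f H x \<tau> =
    (if accepted f H x \<tau> then Some (x + newton_step f H x \<tau>, \<tau>) else ms_backtrack f H x (2 * \<tau>))"
  by (subst ms_backtrack.simps) (simp add: Let_def accepted_def newton_step_def)

text \<open>A rejected trial lies below the threshold \<open>T\<close>, so the next one lies below \<open>2T\<close>. This is where the
factor two between the acceptance threshold and the final bound on \<open>\<tau>\<close> comes from.\<close>

lemma ms_backtrack_terminates:
  assumes "\<tau> > 0" and acc: "\<And>t. t > 0 \<Longrightarrow> T \<le> t \<Longrightarrow> accepted f H x t"
  shows "\<exists>t. ms_backtrack f H x \<tau> = Some (x + newton_step f H x t, t) \<and> accepted f H x t \<and>
    \<tau> \<le> t \<and> t \<le> max \<tau> (2 * T)"
proof -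
  obtain n :: nat where "T / \<tau> < 2 ^ n"
    using real_arch_pow[of 2] by auto
  then have "T \<le> 2 ^ n * \<tau>"
    using \<open>\<tau> > 0\<close> by (simp add: pos_divide_less_eq)
  then show ?thesis
    using \<open>\<tau> > 0\<close>
  proof (induction n arbitrary: \<tau>)
    case 0
    then show ?case using acc by (subst ms_backtrack_rec) auto
  next
    case (Suc n)
    show ?case
    proof (cases "accepted f H x \<tau>")
      case True
      then show ?thesis by (subst ms_backtrack_rec) auto
    next
      case False
      with Suc.prems acc have "\<tau> < T" by force
      moreover obtain t where "ms_backtrack f H x (2 * \<tau>) = Some (x + newton_step f H x t, t)"
        "accepted f H x t" "2 * \<tau> \<le> t" "t \<le> max (2 * \<tau>) (2 * T)"
        using Suc.IH[of "2 * \<tau>"] Suc.prems by (auto simp: mult_ac)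
      ultimately show ?thesis
        using False Suc.prems by (subst ms_backtrack_rec) auto
    qed
  qed
qed

context strongly_convex_C2
begin

lemma regularized_hess_ge:
  assumes "opnorm (A - hess f x) \<le> \<delta>"
  shows "(\<mu> + \<tau> - \<delta>) * (norm v)\<^sup>2 \<le> v \<bullet> ((A + mat \<tau>) *v v)"
proof -
  have "\<bar>v \<bullet> ((A - hess f x) *v v)\<bar> \<le> norm v * norm ((A - hess f x) *v v)"
    by (rule Cauchy_Schwarz_ineq2)
  also have "\<dots> \<le> norm v * (\<delta> * norm v)"
    using norm_mult_le_opnorm[of "A - hess f x" v] mult_right_mono[OF assms, of "norm v"]
    by (intro mult_left_mono) auto
  finally have "- (\<delta> * (norm v)\<^sup>2) \<le> v \<bullet> ((A - hess f x) *v v)"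
    by (simp add: power2_eq_square mult_ac)
  moreover have "v \<bullet> ((A + mat \<tau>) *v v)
      = v \<bullet> ((A - hess f x) *v v) + v \<bullet> (hess f x *v v) + \<tau> * (norm v)\<^sup>2"
    by (simp add: matrix_vector_mult_add_rdistrib matrix_vector_mult_diff_rdistrib mat_mult_vec
        inner_add_right inner_diff_right power2_norm_eq_inner)
  ultimately show ?thesis
    using hess_ge[of v x] by (simp add: algebra_simps)
qed

text \<open>With \<open>m = \<mu> + 3\<tau>/4\<close> the shifted matrix is at least \<open>m I\<close>, hence \<open>m \<parallel>s\<parallel> \<le> \<parallel>\<nabla>f x\<parallel>\<close>. The last two
assumptions are then exactly what places the step in the region where the Hessian estimate holds
and makes the Taylor remainder at most \<open>\<tau> \<parallel>s\<parallel> / 4\<close>; the matrix error uses up the other quarter.\<close>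

lemma acceptedI:
  assumes sym: "transpose (H x) = H x" and \<tau>: "\<tau> > 0" and L: "0 \<le> L"
    and \<delta>: "opnorm (H x - hess f x) \<le> \<tau> / 4"
    and smooth: "\<And>y. norm (y - x) \<le> R \<Longrightarrow> opnorm (hess f y - hess f x) \<le> L * norm (y - x)"
    and R: "norm (grad f x) \<le> (\<mu> + 3 / 4 * \<tau>) * R"
    and Lg: "L * norm (grad f x) \<le> \<tau> / 2 * (\<mu> + 3 / 4 * \<tau>)"
  shows "accepted f H x \<tau>"
proof -
  define s where "s = newton_step f H x \<tau>"
  define m where "m = \<mu> + 3 / 4 * \<tau>"
  have m: "m > 0" using mu_pos \<tau> by (simp add: m_def)
  have ge: "m * (norm v)\<^sup>2 \<le> v \<bullet> ((H x + mat \<tau>) *v v)" for v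
    using regularized_hess_ge[OF \<delta>, of \<tau> v] by (simp add: m_def algebra_simps)
  have "v \<bullet> ((H x + mat \<tau>) *v v) > 0" if "v \<noteq> 0" for v
    using ge[of v] m that by (smt (verit) mult_pos_pos zero_less_norm_iff zero_less_power)
  moreover have "transpose (H x + mat \<tau>) = H x + mat \<tau>"
    using sym by (simp add: transpose_def mat_def vec_eq_iff)
  ultimately have pd: "positive_definite (H x + mat \<tau>)"
    by (simp add: positive_definite_def)
  have Hs: "H x *v s = - grad f x - \<tau> *\<^sub>R s"
    unfolding s_def by (rule newton_step_eq) (rule pd)
  have "m * (norm s)\<^sup>2 \<le> s \<bullet> (- grad f x)"
    using ge[of s] by (simp add: matrix_vector_mult_add_rdistrib mat_mult_vec Hs)
  also have "\<dots> \<le> norm s * norm (grad f x)"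
    using norm_cauchy_schwarz[of s "- grad f x"] by simp
  finally have s_le: "m * norm s \<le> norm (grad f x)"
    by (cases "s = 0") (auto simp: power2_eq_square)
  have "m * norm s \<le> m * R"
    using s_le R by (simp add: m_def)
  then have sR: "norm s \<le> R" using m by simp
  have taylor: "norm (grad f (x + s) - grad f x - hess f x *v s) \<le> L / 2 * (norm s)\<^sup>2"
  proof (rule grad_taylor_bound)
    fix t :: real assume t: "0 \<le> t" "t \<le> 1"
    then have "norm (t *\<^sub>R s) \<le> R"
      using sR mult_right_mono[OF t(2), of "norm s"] by simp
    with t show "opnorm (hess f (x + t *\<^sub>R s) - hess f x) \<le> L * (t * norm s)"
      using smooth[of "x + t *\<^sub>R s"] by simp
  qed
  have "m * (L * norm s) \<le> L * norm (grad f x)"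
    using mult_left_mono[OF s_le L] by (simp add: mult_ac)
  also have "\<dots> \<le> m * (\<tau> / 2)"
    using Lg by (simp add: m_def mult_ac)
  finally have "L * norm s \<le> \<tau> / 2" using m by simp
  then have Ls: "L / 2 * (norm s)\<^sup>2 \<le> \<tau> / 4 * norm s"
    using mult_right_mono[of "L * norm s" "\<tau> / 2" "norm s"] by (simp add: power2_eq_square)
  have "grad f (x + s) + \<tau> *\<^sub>R s =
      (grad f (x + s) - grad f x - hess f x *v s) - (H x - hess f x) *v s"
    by (simp add: matrix_vector_mult_diff_rdistrib Hs)
  then have "norm (grad f (x + s) + \<tau> *\<^sub>R s) \<le>
      norm (grad f (x + s) - grad f x - hess f x *v s) + norm ((H x - hess f x) *v s)"
    by (simp only: norm_triangle_ineq4)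
  also have "norm ((H x - hess f x) *v s) \<le> \<tau> / 4 * norm s"
    using norm_mult_le_opnorm[of "H x - hess f x" s] mult_right_mono[OF \<delta>, of "norm s"] by simp
  finally have "norm (grad f (x + s) + \<tau> *\<^sub>R s) \<le> \<tau> / 2 * norm s"
    using taylor Ls by simp
  with pd show ?thesis
    by (simp add: accepted_def s_def)
qed

text \<open>Write \<open>g\<close> for the gradient at the new point. Squaring the residual condition bounds \<open>- (g \<bullet> s)\<close> from
below by \<open>\<parallel>g\<parallel>\<^sup>2 / (2\<tau>) + 3\<tau> \<parallel>s\<parallel>\<^sup>2 / 8\<close>, and the triangle inequality gives \<open>\<parallel>s\<parallel> \<ge> 2 \<parallel>g\<parallel> / (3\<tau>)\<close>.
Inserting both in the strong convexity inequality at \<open>x + s\<close>, and \<open>\<parallel>g\<parallel>\<^sup>2 \<ge> 2\<mu> D\<close> for the new gap \<open>D\<close>,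
yields an old gap of at least \<open>(1 + 4\<mu> / (3\<tau>) + 4\<mu>\<^sup>2 / (9\<tau>\<^sup>2)) D = (1 + 2\<mu> / (3\<tau>))\<^sup>2 D\<close>.\<close>

lemma gap_contraction_of_residual:
  assumes \<tau>: "\<tau> > 0" and acc: "norm (grad f (x + s) + \<tau> *\<^sub>R s) \<le> \<tau> / 2 * norm s"
    and min: "\<forall>y. f z \<le> f y"
  shows "f (x + s) - f z \<le> (1 - 2 * \<mu> / (3 * \<tau> + 2 * \<mu>))\<^sup>2 * (f x - f z)"
proof -
  define g where "g = grad f (x + s)"
  define D where "D = f (x + s) - f z"
  have D: "D \<ge> 0" using min by (simp add: D_def)
  have gD: "2 * \<mu> * D \<le> (norm g)\<^sup>2"
    unfolding D_def g_def by (rule f_gap_le_grad)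
  have "norm g = norm (g + \<tau> *\<^sub>R s - \<tau> *\<^sub>R s)" by simp
  also have "\<dots> \<le> norm (g + \<tau> *\<^sub>R s) + norm (\<tau> *\<^sub>R s)" by (rule norm_triangle_ineq4)
  also have "\<dots> \<le> 3 / 2 * \<tau> * norm s" using acc \<tau> by (simp add: g_def)
  finally have "(norm g)\<^sup>2 \<le> (3 / 2 * \<tau> * norm s)\<^sup>2"
    by (intro power_mono) auto
  then have gs: "4 * (norm g)\<^sup>2 \<le> 9 * \<tau>\<^sup>2 * (norm s)\<^sup>2"
    by (simp add: power_mult_distrib power_divide)
  have "(norm (g + \<tau> *\<^sub>R s))\<^sup>2 \<le> (\<tau> / 2 * norm s)\<^sup>2"
    using acc by (intro power_mono) (auto simp: g_def)
  moreover have "(norm (g + \<tau> *\<^sub>R s))\<^sup>2 = (norm g)\<^sup>2 + 2 * \<tau> * (g \<bullet> s) + \<tau>\<^sup>2 * (norm s)\<^sup>2"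
    by (simp only: power2_norm_eq_inner)
       (simp add: inner_add_left inner_add_right inner_commute power2_eq_square algebra_simps)
  ultimately have gs': "(norm g)\<^sup>2 + 3 / 4 * \<tau>\<^sup>2 * (norm s)\<^sup>2 \<le> - 2 * \<tau> * (g \<bullet> s)"
    by (simp add: power_mult_distrib power_divide)
  have sc: "f (x + s) - g \<bullet> s + \<mu> / 2 * (norm s)\<^sup>2 \<le> f x"
    using strong_convexity_ineq[of "x + s" x] by (simp add: g_def)
  \<comment> \<open>The inequality is multiplied by \<open>9 \<tau>\<^sup>2\<close> throughout to keep it free of divisions.\<close>
  have "9 * \<tau>\<^sup>2 * (f x - f z) \<ge> 9 * \<tau>\<^sup>2 * (D - g \<bullet> s + \<mu> / 2 * (norm s)\<^sup>2)"
    using sc by (intro mult_left_mono) (auto simp: D_def)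
  moreover have "9 * \<tau>\<^sup>2 * (- (g \<bullet> s)) \<ge> 6 * \<tau> * (norm g)\<^sup>2"
  proof -
    have "4 / 3 * (norm g)\<^sup>2 \<le> - 2 * \<tau> * (g \<bullet> s)" using gs gs' by simp
    from mult_left_mono[OF this, of "9 / 2 * \<tau>"] show ?thesis
      using \<tau> by (simp add: power2_eq_square mult_ac)
  qed
  moreover have "9 * \<tau>\<^sup>2 * (\<mu> / 2 * (norm s)\<^sup>2) \<ge> 2 * \<mu> * (norm g)\<^sup>2"
    using mult_left_mono[OF gs, of "\<mu> / 2"] mu_pos by (simp add: mult_ac)
  moreover have "(6 * \<tau> + 2 * \<mu>) * (norm g)\<^sup>2 \<ge> (6 * \<tau> + 2 * \<mu>) * (2 * \<mu> * D)"
    using gD \<tau> mu_pos by (intro mult_left_mono) auto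
  moreover have "9 * \<tau>\<^sup>2 * (D - g \<bullet> s + \<mu> / 2 * (norm s)\<^sup>2) =
      9 * \<tau>\<^sup>2 * D + 9 * \<tau>\<^sup>2 * (- (g \<bullet> s)) + 9 * \<tau>\<^sup>2 * (\<mu> / 2 * (norm s)\<^sup>2)"
    by algebra
  moreover have "(6 * \<tau> + 2 * \<mu>) * (norm g)\<^sup>2 = 6 * \<tau> * (norm g)\<^sup>2 + 2 * \<mu> * (norm g)\<^sup>2"
    by algebra
  moreover have "9 * \<tau>\<^sup>2 * D + (6 * \<tau> + 2 * \<mu>) * (2 * \<mu> * D) = (3 * \<tau> + 2 * \<mu>)\<^sup>2 * D"
    "9 * \<tau>\<^sup>2 * (f x - f z) = (3 * \<tau>)\<^sup>2 * (f x - f z)"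
    by algebra+
  ultimately have "(3 * \<tau> + 2 * \<mu>)\<^sup>2 * D \<le> (3 * \<tau>)\<^sup>2 * (f x - f z)"
    by linarith
  moreover have "1 - 2 * \<mu> / (3 * \<tau> + 2 * \<mu>) = 3 * \<tau> / (3 * \<tau> + 2 * \<mu>)"
    using \<tau> mu_pos by (simp add: field_simps)
  moreover have "(3 * \<tau> + 2 * \<mu>)\<^sup>2 > 0" using \<tau> mu_pos by simp
  ultimately show ?thesis
    unfolding D_def[symmetric] by (simp add: power_divide pos_le_divide_eq mult.commute)
qed

end

section \<open>The iterates\<close>

definition arn_eta :: "(real^'n \<Rightarrow> real) \<Rightarrow> (real^'n \<Rightarrow> real^'n^'n) \<Rightarrow> real^'n \<Rightarrow> real \<Rightarrow> nat \<Rightarrow> real" where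
  "arn_eta f H x0 \<eta>0 k = snd (the (arn_state f H x0 \<eta>0 k))"

lemma arn_0: "arn_reached f H x0 \<eta>0 0" "arn_x f H x0 \<eta>0 0 = x0" "arn_eta f H x0 \<eta>0 0 = \<eta>0"
  by (simp_all add: arn_reached_def arn_x_def arn_eta_def)

lemma arn_completedD:
  assumes "arn_completed f H x0 \<eta>0 k"
  shows "arn_reached f H x0 \<eta>0 k" "grad f (arn_x f H x0 \<eta>0 k) \<noteq> 0"
  using assms unfolding arn_completed_def arn_reached_def arn_x_def
  by (auto split: option.splits if_splits)

lemma arn_reached_mono: "arn_reached f H x0 \<eta>0 k \<Longrightarrow> j \<le> k \<Longrightarrow> arn_reached f H x0 \<eta>0 j"
  by (induction k) (auto simp: le_Suc_eq dest: arn_completedD(1)[unfolded arn_completed_def])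

lemma arn_step:
  assumes "arn_reached f H x0 \<eta>0 k" "grad f (arn_x f H x0 \<eta>0 k) \<noteq> 0"
    and "ms_backtrack f H (arn_x f H x0 \<eta>0 k) (arn_eta f H x0 \<eta>0 k) = Some (x', t)"
  shows "arn_completed f H x0 \<eta>0 k" "arn_x f H x0 \<eta>0 (Suc k) = x'" "arn_tau f H x0 \<eta>0 k = t"
    "arn_eta f H x0 \<eta>0 (Suc k) = t / 2 * min 1 (norm (grad f x') / norm (grad f (arn_x f H x0 \<eta>0 k)))"
proof -
  obtain x \<eta> where "arn_state f H x0 \<eta>0 k = Some (x, \<eta>)"
    using assms(1) by (auto simp: arn_reached_def)
  then show "arn_completed f H x0 \<eta>0 k" "arn_x f H x0 \<eta>0 (Suc k) = x'" "arn_tau f H x0 \<eta>0 k = t"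
    "arn_eta f H x0 \<eta>0 (Suc k) = t / 2 * min 1 (norm (grad f x') / norm (grad f (arn_x f H x0 \<eta>0 k)))"
    using assms(2,3) by (simp_all add: arn_completed_def arn_reached_def arn_x_def arn_eta_def arn_tau_def)
qed

section \<open>Convergence of the method\<close>

text \<open>The global and the local smoothness hypothesis are merged into one by letting the radius \<open>\<rho>\<close> take the
value \<open>\<infinity>\<close>.\<close>

locale adaptive_newton = strongly_convex_C2 f \<mu>
  for f :: "real^'d \<Rightarrow> real" and \<mu> :: real +
  fixes H :: "real^'d \<Rightarrow> real^'d^'d" and xstar x0 :: "real^'d"
    and M0 M1 \<nu> \<eta>0 :: real and \<rho> :: ereal
  assumes M0: "M0 \<ge> 0" and M1: "M1 \<ge> 0" and nu: "\<nu> > 0" and eta0: "\<eta>0 > 0"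
    and minimizer: "\<forall>y. f xstar \<le> f y"
    and rho: "\<rho> > 0"
    and smooth: "\<And>x y. ereal (norm (y - x)) \<le> \<rho> \<Longrightarrow>
      opnorm (hess f y - hess f x) \<le> (M0 + M1 * norm (grad f x)) * norm (y - x)"
    and H_sym: "\<And>z. transpose (H z) = H z"
    and H_approx: "\<And>k. arn_reached f H x0 \<eta>0 k \<Longrightarrow>
      opnorm (H (arn_x f H x0 \<eta>0 k) - hess f (arn_x f H x0 \<eta>0 k))
        \<le> \<nu> * norm (grad f (arn_x f H x0 \<eta>0 k))"
begin

abbreviation "x \<equiv> arn_x f H x0 \<eta>0"
abbreviation "\<tau> \<equiv> arn_tau f H x0 \<eta>0"
abbreviation "\<eta> \<equiv> arn_eta f H x0 \<eta>0"
abbreviation "reached \<equiv> arn_reached f H x0 \<eta>0"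
abbreviation "completed \<equiv> arn_completed f H x0 \<eta>0"
abbreviation "g k \<equiv> norm (grad f (x k))"
abbreviation "gap k \<equiv> f (x k) - f xstar"

text \<open>The number \<open>\<beta>\<close> is the part of the acceptance threshold due to \<open>M0\<close> and the Hessian error, and \<open>\<alpha>\<close>
is the part due to \<open>M1\<close> and the radius. The radius is infinite exactly for \<open>\<rho> = \<infinity>\<close> and \<open>M1 = 0\<close>, and
then \<open>\<alpha>\<close> vanishes.\<close>

definition "\<beta> = 24 * M0 / \<mu> + 8 * \<nu>"
definition "\<alpha> = real_of_ereal (2 / arn_radius \<rho> M1)"

lemma beta_pos: "\<beta> > 0"
  using M0 nu mu_pos by (simp add: \<beta>_def add_nonneg_pos)

lemma radius_cases:
  obtains "\<rho> = \<infinity>" "M1 = 0" "arn_radius \<rho> M1 = \<infinity>"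
  | r where "arn_radius \<rho> M1 = ereal r" "r > 0" "ereal r \<le> \<rho> / 2" "r * sqrt M1 \<le> 1 / 6"
proof (cases "M1 = 0")
  case True
  then have inf: "1 / (6 * ereal (sqrt M1)) = \<infinity>"
    by (simp add: divide_ereal_def)
  have r0: "arn_radius \<rho> M1 = \<rho> / 2"
    unfolding arn_radius_def inf by simp
  show ?thesis
  proof (cases \<rho>)
    case (real p)
    with rho True r0 show ?thesis
      by (intro that(2)[of "p / 2"]) auto
  qed (use rho True r0 in \<open>auto intro!: that(1)\<close>)
next
  case False
  define q where "q = 1 / (6 * sqrt M1)"
  have q: "q > 0" "q * sqrt M1 = 1 / 6" and q': "1 / (6 * ereal (sqrt M1)) = ereal q"
    using False M1 by (auto simp: q_def divide_ereal_def inverse_eq_divide)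
  show ?thesis
  proof (cases \<rho>)
    case (real p)
    have "min (p / 2) q * sqrt M1 \<le> q * sqrt M1"
      using M1 by (intro mult_right_mono) auto
    with real rho q q' show ?thesis
      by (intro that(2)[of "min (p / 2) q"]) (auto simp: arn_radius_def)
  next
    case PInf
    with q q' show ?thesis
      by (intro that(2)[of q]) (auto simp: arn_radius_def)
  qed (use rho in auto)
qed

text \<open>These consequences are all that is used of the radius: an \<open>\<alpha>\<close>-multiple of the gradient controls the
\<open>M1\<close>-term, and it keeps the step within \<open>\<rho>\<close>. The constant four leaves room for the factor \<open>4/3\<close> by which
\<open>\<parallel>\<nabla>f x\<parallel> / \<tau>\<close> may underestimate the step.\<close>

lemma alpha_facts:
  shows ereal_alpha: "ereal \<alpha> = 2 / arn_radius \<rho> M1"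
    and alpha_nonneg: "\<alpha> \<ge> 0"
    and alpha_M1: "144 * M1 \<le> \<alpha>\<^sup>2"
    and alpha_rho: "\<And>t. \<alpha> * t \<le> 4 \<Longrightarrow> ereal t \<le> \<rho>"
proof -
  have "ereal \<alpha> = 2 / arn_radius \<rho> M1 \<and> \<alpha> \<ge> 0 \<and> 144 * M1 \<le> \<alpha>\<^sup>2 \<and>
      (\<forall>t. \<alpha> * t \<le> 4 \<longrightarrow> ereal t \<le> \<rho>)"
  proof (cases rule: radius_cases)
    case 1
    have \<alpha>: "\<alpha> = 0"
      unfolding \<alpha>_def 1(3) by simp
    show ?thesis
      unfolding \<alpha> 1(3) by (simp add: 1(1,2))
  next
    case (2 r)
    have \<alpha>: "\<alpha> = 2 / r"
      using 2 by (simp add: \<alpha>_def)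
    have "(12 * sqrt M1)\<^sup>2 \<le> \<alpha>\<^sup>2"
      using 2 M1 by (intro power_mono) (auto simp: \<alpha> field_simps)
    then have "144 * M1 \<le> \<alpha>\<^sup>2"
      using M1 by (simp add: power_mult_distrib)
    moreover have "ereal t \<le> \<rho>" if "\<alpha> * t \<le> 4" for t
    proof -
      have "t \<le> 2 * r" using that 2(2) by (simp add: \<alpha> field_simps)
      then have "ereal t \<le> ereal (2 * r)" by simp
      also have "\<dots> \<le> \<rho>" using 2(3) by (cases \<rho>) auto
      finally show ?thesis .
    qed
    ultimately show ?thesis
      using 2 \<alpha> by simp
  qed
  then show "ereal \<alpha> = 2 / arn_radius \<rho> M1" "\<alpha> \<ge> 0" "144 * M1 \<le> \<alpha>\<^sup>2"
    "\<And>t. \<alpha> * t \<le> 4 \<Longrightarrow> ereal t \<le> \<rho>"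
    by blast+
qed

text \<open>The threshold \<open>\<beta>\<close> settles the Hessian error and the \<open>M0\<close>-term, the latter costing one sixth of \<open>\<mu>\<close>.
The radius and the \<open>M1\<close>-term are left as assumptions because they are handled differently far from
and close to the minimizer.\<close>

lemma accepted_iterate:
  assumes k: "reached k" and t: "t > 0" and bt: "\<beta> * g k \<le> 2 * t"
    and R: "ereal R \<le> \<rho>" "g k \<le> (\<mu> + 3 / 4 * t) * R"
    and M1g: "M1 * (g k)\<^sup>2 \<le> t / 2 * (5 / 6 * \<mu> + 3 / 4 * t)"
  shows "accepted f H (x k) t"
proof (rule acceptedI[where R = R and L = "M0 + M1 * g k"])
  have split: "24 * (M0 * g k) / \<mu> + 8 * (\<nu> * g k) \<le> 2 * t"
    using bt by (simp add: \<beta>_def algebra_simps)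
  have nonneg: "24 * (M0 * g k) / \<mu> \<ge> 0" "8 * (\<nu> * g k) \<ge> 0"
    using M0 nu mu_pos by auto
  have "\<nu> * g k \<le> t / 4"
    using split nonneg by linarith
  with H_approx[OF k] show "opnorm (H (x k) - hess f (x k)) \<le> t / 4"
    by linarith
  have "24 * (M0 * g k) / \<mu> \<le> 2 * t"
    using split nonneg by linarith
  then have "12 * (M0 * g k) \<le> t * \<mu>"
    using mu_pos by (simp add: pos_divide_le_eq mult.commute)
  then show "(M0 + M1 * g k) * g k \<le> t / 2 * (\<mu> + 3 / 4 * t)"
    using M1g by (simp add: algebra_simps power2_eq_square)
  show "opnorm (hess f y - hess f (x k)) \<le> (M0 + M1 * g k) * norm (y - x k)"
    if "norm (y - x k) \<le> R" for y
    using that R(1) by (intro smooth) (meson ereal_less_eq(3) order_trans)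
qed (use H_sym t M0 M1 R(2) in auto)

text \<open>Here the step is bounded through \<open>\<tau>\<close>: \<open>\<parallel>s\<parallel> \<le> 4 \<parallel>\<nabla>f x\<parallel> / (3\<tau>)\<close>.\<close>

lemma accepted_global:
  assumes k: "reached k" and t: "t > 0" and B: "max \<beta> \<alpha> * g k \<le> 2 * t"
  shows "accepted f H (x k) t"
proof -
  have bg: "\<beta> * g k \<le> 2 * t" and ag: "\<alpha> * g k \<le> 2 * t"
    using B mult_right_mono[of \<beta> "max \<beta> \<alpha>" "g k"] mult_right_mono[of \<alpha> "max \<beta> \<alpha>" "g k"] by auto
  define R where "R = 4 * g k / (3 * t)"
  have "\<alpha> * R \<le> 4"
    using ag t by (simp add: R_def field_simps)
  then have "ereal R \<le> \<rho>" by (rule alpha_rho)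
  moreover have "g k \<le> (\<mu> + 3 / 4 * t) * R"
  proof -
    have "3 / 4 * t * R = g k" "\<mu> * R \<ge> 0"
      using t mu_pos by (auto simp: R_def)
    then show ?thesis by (simp add: distrib_right)
  qed
  moreover have "M1 * (g k)\<^sup>2 \<le> t / 2 * (5 / 6 * \<mu> + 3 / 4 * t)"
  proof -
    have "144 * M1 * (g k)\<^sup>2 \<le> \<alpha>\<^sup>2 * (g k)\<^sup>2"
      by (intro mult_right_mono alpha_M1) auto
    also have "\<dots> = (\<alpha> * g k)\<^sup>2" by (simp add: power_mult_distrib)
    also have "\<dots> \<le> (2 * t)\<^sup>2"
      using ag alpha_nonneg by (intro power_mono) auto
    finally have "36 * (M1 * (g k)\<^sup>2) \<le> t * t" by (simp add: power2_eq_square)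
    moreover have "t * \<mu> \<ge> 0" "t * t \<ge> 0" using t mu_pos by auto
    moreover have "t / 2 * (5 / 6 * \<mu> + 3 / 4 * t) = 5 / 12 * (t * \<mu>) + 3 / 8 * (t * t)"
      by (simp add: algebra_simps)
    ultimately show ?thesis by linarith
  qed
  ultimately show ?thesis
    by (rule accepted_iterate[OF k t bg])
qed

text \<open>Here the step is bounded through strong convexity, \<open>\<parallel>s\<parallel> \<le> \<parallel>\<nabla>f x\<parallel> / \<mu>\<close>, and the smallness
of the gradient takes over the role of \<open>\<alpha>\<close>: the part \<open>8\<nu>\<close> of \<open>\<beta>\<close> absorbs the \<open>M1\<close>-term.\<close>

lemma accepted_local:
  assumes k: "reached k" and t: "t > 0" and bg: "\<beta> * g k \<le> 2 * t"
    and near: "M1 * g k \<le> \<nu> * \<mu>" "ereal (g k / \<mu>) \<le> \<rho>"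
  shows "accepted f H (x k) t"
proof (rule accepted_iterate[OF k t bg near(2)])
  have "t * (g k / \<mu>) \<ge> 0" using t mu_pos by simp
  moreover have "(\<mu> + 3 / 4 * t) * (g k / \<mu>) = g k + 3 / 4 * (t * (g k / \<mu>))"
    using mu_pos by (simp add: field_simps)
  ultimately show "g k \<le> (\<mu> + 3 / 4 * t) * (g k / \<mu>)"
    by linarith
  have "24 * (M0 / \<mu>) * g k \<ge> 0" using M0 mu_pos by simp
  then have "4 * (\<nu> * g k) \<le> t"
    using bg by (simp add: \<beta>_def algebra_simps)
  then have "4 * (\<mu> * (\<nu> * g k)) \<le> \<mu> * t"
    using mult_left_mono[of "4 * (\<nu> * g k)" t \<mu>] mu_pos by simp
  moreover have "M1 * (g k)\<^sup>2 \<le> \<mu> * (\<nu> * g k)"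
    using mult_right_mono[OF near(1), of "g k"] by (simp add: power2_eq_square mult_ac)
  moreover have "\<mu> * t \<ge> 0" "t * t \<ge> 0" using t mu_pos by auto
  moreover have "t / 2 * (5 / 6 * \<mu> + 3 / 4 * t) = 5 / 12 * (\<mu> * t) + 3 / 8 * (t * t)"
    by (simp add: algebra_simps)
  ultimately show "M1 * (g k)\<^sup>2 \<le> t / 2 * (5 / 6 * \<mu> + 3 / 4 * t)"
    by linarith
qed

text \<open>The constant \<open>c\<close> is left open: it is \<open>max \<beta> \<alpha>\<close> globally and \<open>\<beta>\<close> near the minimizer.\<close>

lemma iteration_of_threshold:
  assumes k: "reached k" and g: "grad f (x k) \<noteq> 0" and e: "\<eta> k > 0"
    and acc: "\<And>t. t > 0 \<Longrightarrow> c * g k \<le> 2 * t \<Longrightarrow> accepted f H (x k) t"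
  shows "completed k \<and> accepted f H (x k) (\<tau> k) \<and> x (Suc k) = x k + newton_step f H (x k) (\<tau> k) \<and>
    \<eta> (Suc k) = \<tau> k / 2 * min 1 (g (Suc k) / g k) \<and> \<eta> k \<le> \<tau> k \<and> \<tau> k \<le> max (\<eta> k) (c * g k)"
proof -
  have "accepted f H (x k) t" if "t > 0" "c * g k / 2 \<le> t" for t
    using that by (intro acc) auto
  from ms_backtrack_terminates[where T = "c * g k / 2", OF e this]
  obtain t where t: "ms_backtrack f H (x k) (\<eta> k) = Some (x k + newton_step f H (x k) t, t)"
      "accepted f H (x k) t" "\<eta> k \<le> t" "t \<le> max (\<eta> k) (c * g k)"
    by auto
  note step = arn_step[OF k g t(1)]
  show ?thesis
    using t step(1,4) unfolding step(2,3) by blast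
qed

lemma eta_pos: "reached k \<Longrightarrow> grad f (x k) \<noteq> 0 \<Longrightarrow> \<eta> k > 0"
proof (induction k)
  case 0
  then show ?case using eta0 by (simp add: arn_0)
next
  case (Suc k)
  then have k: "reached k" "grad f (x k) \<noteq> 0"
    using arn_completedD unfolding arn_completed_def by blast+
  with Suc.IH have e: "\<eta> k > 0" by blast
  note it = iteration_of_threshold[where c = "max \<beta> \<alpha>", OF k e accepted_global[OF k(1)]]
  have "\<tau> k > 0"
    using it e by linarith
  moreover have "min 1 (g (Suc k) / g k) > 0"
    using k(2) Suc.prems(2) by simp
  ultimately have "\<tau> k / 2 * min 1 (g (Suc k) / g k) > 0"
    by (intro mult_pos_pos) auto
  with it show ?case by metis
qed

lemma iteration:
  assumes "reached k" "grad f (x k) \<noteq> 0"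
  shows "completed k" and "\<tau> k > 0" and "x (Suc k) = x k + newton_step f H (x k) (\<tau> k)"
    and "accepted f H (x k) (\<tau> k)" and "\<eta> (Suc k) \<le> \<tau> k / 2 * (g (Suc k) / g k)"
proof -
  note e = eta_pos[OF assms]
  note it = iteration_of_threshold[where c = "max \<beta> \<alpha>", OF assms e accepted_global[OF assms(1)]]
  from it show "completed k" "x (Suc k) = x k + newton_step f H (x k) (\<tau> k)"
    "accepted f H (x k) (\<tau> k)"
    by blast+
  from it e show pos: "\<tau> k > 0" by linarith
  have "\<tau> k / 2 * min 1 (g (Suc k) / g k) \<le> \<tau> k / 2 * (g (Suc k) / g k)"
    using pos by (intro mult_left_mono) auto
  with it show "\<eta> (Suc k) \<le> \<tau> k / 2 * (g (Suc k) / g k)" by metis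
qed

text \<open>By induction the starting trial satisfies \<open>\<eta> \<le> m \<parallel>\<nabla>f x\<parallel>\<close>, where \<open>m\<close> is the maximum of a halving
quantity and \<open>c\<close>. Backtracking preserves this bound because \<open>m \<ge> c\<close>, and the update of \<open>\<eta>\<close> halves it
while replacing the old gradient norm by the new one.\<close>

lemma eta_tau_halving:
  assumes K: "reached K" and c: "c \<ge> 0"
    and acc: "\<And>k t. k \<ge> K \<Longrightarrow> reached k \<Longrightarrow> t > 0 \<Longrightarrow> c * g k \<le> 2 * t \<Longrightarrow> accepted f H (x k) t"
    and comp: "completed (K + j)"
  shows "\<tau> (K + j) \<le> max ((1 / 2) ^ j * \<eta> K / g K) c * g (K + j)"
proof -
  define m where "m i = max ((1 / 2) ^ i * \<eta> K / g K) c" for i :: nat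
  have tau_le: "\<tau> (K + i) \<le> m i * g (K + i)"
    if i: "reached (K + i)" "grad f (x (K + i)) \<noteq> 0" "\<eta> (K + i) \<le> m i * g (K + i)" for i
  proof -
    have "\<tau> (K + i) \<le> max (\<eta> (K + i)) (c * g (K + i))"
      using iteration_of_threshold[OF i(1,2) eta_pos[OF i(1,2)] acc[OF _ i(1)]] by auto
    moreover have "c * g (K + i) \<le> m i * g (K + i)"
      by (intro mult_right_mono) (auto simp: m_def)
    ultimately show ?thesis using i(3) by linarith
  qed
  have "\<eta> (K + i) \<le> m i * g (K + i)" if "reached (K + i)" "grad f (x (K + i)) \<noteq> 0" for i
    using that
  proof (induction i)
    case 0
    then have "\<eta> K = \<eta> K / g K * g K" by simp
    also have "\<dots> \<le> m 0 * g K" by (intro mult_right_mono) (auto simp: m_def)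
    finally show ?case by simp
  next
    case (Suc i)
    then have i: "reached (K + i)" "grad f (x (K + i)) \<noteq> 0"
      using arn_completedD[of f H x0 \<eta>0 "K + i"] by (auto simp: arn_completed_def)
    have "\<eta> (K + Suc i) \<le> \<tau> (K + i) / 2 * (g (K + Suc i) / g (K + i))"
      using iteration(5)[OF i] by simp
    also have "\<dots> = \<tau> (K + i) / g (K + i) / 2 * g (K + Suc i)"
      by simp
    also have "\<dots> \<le> m (Suc i) * g (K + Suc i)"
    proof (intro mult_right_mono)
      have "\<tau> (K + i) / g (K + i) \<le> m i"
        using tau_le[OF i Suc.IH[OF i]] i(2) by (simp add: pos_divide_le_eq)
      then have "\<tau> (K + i) / g (K + i) / 2 \<le> m i / 2"
        by (rule divide_right_mono) simp
      also have "m i / 2 \<le> m (Suc i)" using c by (auto simp: m_def max_def)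
      finally show "\<tau> (K + i) / g (K + i) / 2 \<le> m (Suc i)" .
    qed simp
    finally show ?case .
  qed
  then show ?thesis
    using tau_le arn_completedD[OF comp] unfolding m_def by blast
qed

lemma tau_le:
  assumes "completed k"
  shows "\<tau> k \<le> max ((1 / 2) ^ k * \<eta>0 / norm (grad f x0)) (max \<beta> \<alpha>) * g k"
  using eta_tau_halving[of 0 "max \<beta> \<alpha>" k] accepted_global assms beta_pos by (simp add: arn_0)

lemma gap_decrease:
  assumes "completed k"
  shows "gap (Suc k) \<le> (1 - 2 * \<mu> / (3 * \<tau> k + 2 * \<mu>))\<^sup>2 * gap k"
proof -
  note k = arn_completedD[OF assms]
  show ?thesis
    unfolding iteration(3)[OF k]
    using iteration(2,4)[OF k] minimizer by (intro gap_contraction_of_residual) (auto simp: accepted_def)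
qed

lemma gap_nonneg: "gap k \<ge> 0"
  using minimizer by simp

lemma finite_termination_or_completed:
  "(\<exists>k. reached k \<and> grad f (x k) = 0) \<or> (\<forall>k. completed k)"
proof (rule disjCI)
  assume "\<not> (\<forall>k. completed k)"
  show "\<exists>k. reached k \<and> grad f (x k) = 0"
  proof (rule ccontr)
    assume no: "\<nexists>k. reached k \<and> grad f (x k) = 0"
    have "reached k" for k
      by (induction k) (use no iteration(1) in \<open>auto simp: arn_0 arn_completed_def\<close>)
    with no iteration(1) \<open>\<not> (\<forall>k. completed k)\<close> show False by blast
  qed
qed

text \<open>The gap never increases, so strong convexity confines the iterates to a ball. There the gradient is
bounded, hence so is \<open>\<tau>\<close> by \<open>tau_le\<close>, and the contraction factors stay away from one.\<close>

lemma iterates_converge: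
  assumes all: "\<And>k. completed k"
  shows "x \<longlonglongrightarrow> xstar" and "\<tau> \<longlonglongrightarrow> 0"
proof -
  define q where "q t = 1 - 2 * \<mu> / (3 * t + 2 * \<mu>)" for t
  have gap_le: "gap (Suc k) \<le> (q (\<tau> k))\<^sup>2 * gap k" for k
    unfolding q_def by (rule gap_decrease[OF all])
  have tau: "\<tau> k > 0" for k
    using iteration(2)[OF arn_completedD[OF all]] .
  have q: "0 \<le> q t" "q t < 1" if "t > 0" for t
    using that mu_pos by (auto simp: q_def pos_divide_le_eq)
  have "gap (Suc k) \<le> gap k" for k
  proof -
    have "(q (\<tau> k))\<^sup>2 \<le> 1" using q[OF tau[of k]] by (simp add: power_le_one)
    then have "(q (\<tau> k))\<^sup>2 * gap k \<le> gap k" using gap_nonneg[of k] by (simp add: mult_left_le_one_le)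
    with gap_le[of k] show ?thesis by linarith
  qed
  then have gap_le0: "gap k \<le> gap 0" for k
    by (induction k) (auto intro: order_trans)
  have "x k \<in> cball xstar (sqrt (2 * gap 0 / \<mu>))" for k
  proof -
    have "\<mu> / 2 * (norm (x k - xstar))\<^sup>2 \<le> gap 0"
      using dist_minimizer_le[OF minimizer, of "x k"] gap_le0[of k] by linarith
    then have "(norm (x k - xstar))\<^sup>2 \<le> 2 * gap 0 / \<mu>"
      using mu_pos by (simp add: pos_le_divide_eq mult_ac)
    then show ?thesis
      by (simp add: dist_norm norm_minus_commute real_le_rsqrt)
  qed
  moreover have "bounded (grad f ` cball xstar (sqrt (2 * gap 0 / \<mu>)))"
    using isCont_grad
    by (intro compact_imp_bounded compact_continuous_image) (auto intro: continuous_at_imp_continuous_on)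
  ultimately obtain G where G: "\<And>k. g k \<le> G"
    unfolding bounded_iff by blast
  define A where "A = max (\<eta>0 / norm (grad f x0)) (max \<beta> \<alpha>)"
  have "A > 0" using beta_pos by (simp add: A_def less_max_iff_disj)
  have tau_A: "\<tau> k \<le> A * g k" for k
  proof -
    have "(1 / 2) ^ k * \<eta>0 / norm (grad f x0) \<le> \<eta>0 / norm (grad f x0)"
      using eta0 by (intro divide_right_mono) (auto simp: power_le_one mult_left_le_one_le)
    then have "max ((1 / 2) ^ k * \<eta>0 / norm (grad f x0)) (max \<beta> \<alpha>) \<le> A"
      unfolding A_def by (intro max.mono) auto
    from mult_right_mono[OF this norm_ge_zero] tau_le[OF all, of k] show ?thesis
      by (rule order_trans[rotated])
  qed
  define T where "T = A * G"
  have tau_T: "\<tau> k \<le> T" for k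
    using tau_A[of k] mult_left_mono[OF G[of k], of A] \<open>A > 0\<close> unfolding T_def by linarith
  then have "T > 0" using tau[of 0] by (meson less_le_trans)
  have "gap k \<le> ((q T)\<^sup>2) ^ k * gap 0" for k
  proof (induction k)
    case (Suc k)
    have "q (\<tau> k) \<le> q T"
      unfolding q_def using tau_T[of k] tau[of k] mu_pos
      by (intro diff_left_mono divide_left_mono) (auto intro!: mult_pos_pos add_pos_pos simp: \<open>T > 0\<close>)
    then have "(q (\<tau> k))\<^sup>2 \<le> (q T)\<^sup>2"
      using q(1)[OF tau] by (intro power_mono)
    then have "(q (\<tau> k))\<^sup>2 * gap k \<le> (q T)\<^sup>2 * (((q T)\<^sup>2) ^ k * gap 0)"
      by (intro mult_mono Suc.IH gap_nonneg) auto
    with gap_le[of k] show ?case by simp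
  qed simp
  moreover have "(\<lambda>k. ((q T)\<^sup>2) ^ k * gap 0) \<longlonglongrightarrow> 0"
    using q[OF \<open>T > 0\<close>] by (intro tendsto_mult_left_zero LIMSEQ_power_zero) (auto simp: power_less_one_iff abs_square_less_1)
  ultimately have gap0: "gap \<longlonglongrightarrow> 0"
    using real_tendsto_sandwich[of "\<lambda>_. 0" gap sequentially "\<lambda>k. ((q T)\<^sup>2) ^ k * gap 0" 0] gap_nonneg by simp
  have "(\<lambda>k. (norm (x k - xstar))\<^sup>2) \<longlonglongrightarrow> 0"
  proof (rule tendsto_sandwich[OF _ _ tendsto_const])
    show "(\<lambda>k. 2 / \<mu> * gap k) \<longlonglongrightarrow> 0"
      using tendsto_mult_left[OF gap0, of "2 / \<mu>"] by simp
    have "(norm (x k - xstar))\<^sup>2 \<le> 2 / \<mu> * gap k" for k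
      using dist_minimizer_le[OF minimizer, of "x k"] mu_pos by (simp add: field_simps)
    then show "\<forall>\<^sub>F k in sequentially. (norm (x k - xstar))\<^sup>2 \<le> 2 / \<mu> * gap k"
      by simp
  qed simp
  then have "(\<lambda>k. sqrt ((norm (x k - xstar))\<^sup>2)) \<longlonglongrightarrow> sqrt 0"
    by (rule tendsto_real_sqrt)
  then show lim: "x \<longlonglongrightarrow> xstar"
    by (simp add: tendsto_norm_zero_iff LIM_zero_iff)
  have "(\<lambda>k. g k) \<longlonglongrightarrow> 0"
    using tendsto_norm[OF isCont_tendsto_compose[OF isCont_grad lim]] grad_minimizer[OF minimizer] by simp
  then have "(\<lambda>k. A * g k) \<longlonglongrightarrow> 0"
    by (rule tendsto_mult_right_zero)
  moreover have "\<forall>\<^sub>F k in sequentially. 0 \<le> \<tau> k" "\<forall>\<^sub>F k in sequentially. \<tau> k \<le> A * g k"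
    using less_imp_le[OF tau] tau_A by simp_all
  ultimately show "\<tau> \<longlonglongrightarrow> 0"
    using real_tendsto_sandwich[of "\<lambda>_. 0" \<tau> sequentially "\<lambda>k. A * g k" 0] by simp
qed

lemma superlinear:
  assumes all: "\<And>k. completed k"
  shows "(\<lambda>k. gap (Suc k) / gap k) \<longlonglongrightarrow> 0"
proof (rule tendsto_sandwich[OF _ _ tendsto_const])
  have "(\<lambda>k. (1 - 2 * \<mu> / (3 * \<tau> k + 2 * \<mu>))\<^sup>2) \<longlonglongrightarrow> (1 - 2 * \<mu> / (3 * 0 + 2 * \<mu>))\<^sup>2"
    using mu_pos by (intro tendsto_intros iterates_converge(2)[OF all]) auto
  then show "(\<lambda>k. (1 - 2 * \<mu> / (3 * \<tau> k + 2 * \<mu>))\<^sup>2) \<longlonglongrightarrow> 0"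
    using mu_pos by simp
  show "\<forall>\<^sub>F k in sequentially. 0 \<le> gap (Suc k) / gap k"
    by (intro always_eventually allI divide_nonneg_nonneg gap_nonneg)
  have "gap (Suc k) / gap k \<le> (1 - 2 * \<mu> / (3 * \<tau> k + 2 * \<mu>))\<^sup>2" for k
  proof (cases "gap k = 0")
    case False
    then have "gap k > 0" using gap_nonneg[of k] by linarith
    then show ?thesis
      using gap_decrease[OF all, of k] by (simp only: pos_divide_le_eq)
  qed simp
  then show "\<forall>\<^sub>F k in sequentially. gap (Suc k) / gap k \<le> (1 - 2 * \<mu> / (3 * \<tau> k + 2 * \<mu>))\<^sup>2"
    by simp
qed

text \<open>Once the gradients are small enough for \<open>accepted_local\<close>, say from \<open>K\<close> on, the halving argument is
restarted at \<open>K\<close> with \<open>c = \<beta>\<close>. Since \<open>\<beta> > 0\<close>, the halving term drops below \<open>\<beta>\<close> after finitely many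
iterations.\<close>

lemma eventually_tau_le:
  assumes all: "\<And>k. completed k"
  shows "\<forall>\<^sub>F k in sequentially. \<tau> k \<le> \<beta> * g k"
proof -
  have g0: "(\<lambda>k. g k) \<longlonglongrightarrow> 0"
    using tendsto_norm[OF isCont_tendsto_compose[OF isCont_grad iterates_converge(1)[OF all]]]
      grad_minimizer[OF minimizer] by simp
  obtain p where p: "p > 0" "ereal p \<le> \<rho>"
    using rho by (metis ereal_dense2 ereal_less(2) less_ereal.simps(1) less_imp_le zero_ereal_def)
  have "\<forall>\<^sub>F k in sequentially. M1 * g k < \<nu> * \<mu>"
    using tendsto_mult_right_zero[OF g0, of M1] nu mu_pos by (auto intro!: order_tendstoD(2))
  moreover have "\<forall>\<^sub>F k in sequentially. g k < p * \<mu>"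
    using g0 p mu_pos by (auto intro!: order_tendstoD(2))
  ultimately have "\<forall>\<^sub>F k in sequentially. M1 * g k \<le> \<nu> * \<mu> \<and> ereal (g k / \<mu>) \<le> \<rho>"
  proof eventually_elim
    case (elim k)
    then have "ereal (g k / \<mu>) \<le> ereal p" using mu_pos by (simp add: pos_divide_le_eq)
    then have "ereal (g k / \<mu>) \<le> \<rho>" using p(2) by (rule order_trans)
    with elim(1) show ?case by simp
  qed
  then obtain K where K: "\<And>k. k \<ge> K \<Longrightarrow> M1 * g k \<le> \<nu> * \<mu> \<and> ereal (g k / \<mu>) \<le> \<rho>"
    unfolding eventually_sequentially by blast
  have halving: "\<tau> (K + j) \<le> max ((1 / 2) ^ j * \<eta> K / g K) \<beta> * g (K + j)" for j
    using arn_completedD[OF all] all beta_pos K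
    by (intro eta_tau_halving accepted_local) auto
  have "(\<lambda>j. (1 / 2) ^ j * \<eta> K / g K) \<longlonglongrightarrow> 0 * \<eta> K / g K"
    using arn_completedD(2)[OF all] by (intro tendsto_intros LIMSEQ_power_zero) auto
  then have "\<forall>\<^sub>F j in sequentially. (1 / 2) ^ j * \<eta> K / g K < \<beta>"
    using beta_pos by (intro order_tendstoD(2)) auto
  then have "\<forall>\<^sub>F j in sequentially. \<tau> (j + K) \<le> \<beta> * g (j + K)"
  proof eventually_elim
    case (elim j)
    then have "max ((1 / 2) ^ j * \<eta> K / g K) \<beta> = \<beta>" by simp
    with halving[of j] show ?case by (simp add: add.commute)
  qed
  then show ?thesis
    by (simp only: eventually_sequentially_seg[of "\<lambda>k. \<tau> k \<le> \<beta> * g k"])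
qed

lemma eventually_quadratic:
  assumes all: "\<And>k. completed k"
  shows "\<forall>\<^sub>F k in sequentially.
    gap (Suc k) \<le> 9 * (opnorm (hess f xstar) + \<mu>) / (2 * \<mu>\<^sup>2) * \<beta>\<^sup>2 * (gap k)\<^sup>2"
proof -
  have "\<forall>\<^sub>F k in sequentially. (g k)\<^sup>2 \<le> 2 * (opnorm (hess f xstar) + \<mu>) * gap k"
    by (rule eventually_compose_filterlim[OF eventually_grad_sq_le_f_gap[OF minimizer] iterates_converge(1)[OF all]])
  with eventually_tau_le[OF all] show ?thesis
  proof eventually_elim
    case (elim k)
    define L where "L = opnorm (hess f xstar) + \<mu>"
    have tau: "\<tau> k > 0" using iteration(2)[OF arn_completedD[OF all]] .
    have "1 - 2 * \<mu> / (3 * \<tau> k + 2 * \<mu>) = 3 * \<tau> k / (3 * \<tau> k + 2 * \<mu>)"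
      using tau mu_pos by (simp add: field_simps)
    also have "\<dots> \<le> 3 * \<tau> k / (2 * \<mu>)"
      using tau mu_pos by (intro divide_left_mono) auto
    finally have "(1 - 2 * \<mu> / (3 * \<tau> k + 2 * \<mu>))\<^sup>2 \<le> (3 * \<tau> k / (2 * \<mu>))\<^sup>2"
      using tau mu_pos by (intro power_mono) (auto simp: pos_divide_le_eq)
    then have "gap (Suc k) \<le> (3 * \<tau> k / (2 * \<mu>))\<^sup>2 * gap k"
      using gap_decrease[OF all, of k] mult_right_mono[OF _ gap_nonneg[of k]] by (meson order_trans)
    also have "(3 * \<tau> k / (2 * \<mu>))\<^sup>2 = 9 / (4 * \<mu>\<^sup>2) * (\<tau> k)\<^sup>2"
      by (simp add: power_divide power_mult_distrib)
    also have "\<dots> * gap k \<le> 9 / (4 * \<mu>\<^sup>2) * (\<beta>\<^sup>2 * (2 * L * gap k)) * gap k"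
    proof (intro mult_right_mono mult_left_mono gap_nonneg)
      have "(\<tau> k)\<^sup>2 \<le> (\<beta> * g k)\<^sup>2"
        using elim(1) tau by (intro power_mono) auto
      also have "\<dots> = \<beta>\<^sup>2 * (g k)\<^sup>2" by (simp add: power_mult_distrib)
      also have "\<dots> \<le> \<beta>\<^sup>2 * (2 * L * gap k)"
        using elim(2) unfolding L_def by (intro mult_left_mono) auto
      finally show "(\<tau> k)\<^sup>2 \<le> \<beta>\<^sup>2 * (2 * L * gap k)" .
    qed simp
    also have "\<dots> = 9 * L / (2 * \<mu>\<^sup>2) * \<beta>\<^sup>2 * (gap k)\<^sup>2"
      by (simp add: power2_eq_square)
    finally show ?case unfolding L_def .
  qed
qed

end

theorem theorem3p4:
  fixes f :: "real^'d \<Rightarrow> real" and H :: "real^'d \<Rightarrow> real^'d^'d"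
    and xstar x0 :: "real^'d" and \<mu> M0 M1 \<nu> \<eta>0 :: real and \<rho> :: ereal
  defines "x \<equiv> arn_x f H x0 \<eta>0" and "\<tau> \<equiv> arn_tau f H x0 \<eta>0"
    and "reached \<equiv> arn_reached f H x0 \<eta>0" and "completed \<equiv> arn_completed f H x0 \<eta>0"
    and "r0 \<equiv> arn_radius \<rho> M1"
    and "C \<equiv> 9 * (opnorm (hess f xstar) + \<mu>) / (2 * \<mu>\<^sup>2) * (8 * \<nu> + 24 * M0 / \<mu>)\<^sup>2"
  assumes "\<mu> > 0" and "M0 \<ge> 0" and "M1 \<ge> 0" and "\<nu> > 0" and "\<eta>0 > 0"
    and "twice_continuously_differentiable f"
    and "strongly_convex \<mu> f"
    and "\<forall>y. f xstar \<le> f y"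
    and "(\<rho> = \<infinity> \<and> global_hessian_smooth M0 M1 f) \<or>
         (\<exists>r>0. \<rho> = ereal r \<and> local_hessian_smooth r M0 M1 f)"
    and "\<forall>z. transpose (H z) = H z"
    and "\<forall>k. reached k \<longrightarrow> opnorm (H (x k) - hess f (x k)) \<le> \<nu> * norm (grad f (x k))"
  shows
    "((\<exists>k. reached k \<and> grad f (x k) = 0 \<and> (\<forall>y. f (x k) \<le> f y)) \<or>
      ((\<forall>k. completed k) \<and>
       (\<lambda>k. (f (x (Suc k)) - f xstar) / (f (x k) - f xstar)) \<longlonglongrightarrow> 0)) \<and>
     (\<forall>k. completed k \<longrightarrow>
        ereal (\<tau> k) \<le>
          max (ereal ((1 / 2) ^ k * \<eta>0 / norm (grad f x0)))
            (max (ereal (24 * M0 / \<mu> + 8 * \<nu>)) (2 / r0)) * ereal (norm (grad f (x k))) \<and>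
        f (x (Suc k)) - f xstar \<le>
          (1 - 2 * \<mu> / (3 * \<tau> k + 2 * \<mu>))\<^sup>2 * (f (x k) - f xstar)) \<and>
     (\<forall>K0\<ge>1. reached K0 \<and>
        ereal (f (x K0) - f xstar) \<le> min (ereal \<mu> * r0\<^sup>2 / 8) (ereal (1 / (2 * C))) \<longrightarrow>
        (\<exists>K\<ge>K0. \<forall>k\<ge>K. completed k \<longrightarrow>
           f (x (Suc k)) - f xstar \<le> C * (f (x k) - f xstar)\<^sup>2))"
proof -
  have smooth: "opnorm (hess f v - hess f u) \<le> (M0 + M1 * norm (grad f u)) * norm (v - u)"
    if "ereal (norm (v - u)) \<le> \<rho>" for u v
    using assms(15)
  proof
    assume "\<rho> = \<infinity> \<and> global_hessian_smooth M0 M1 f"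
    then show ?thesis unfolding global_hessian_smooth_def by blast
  next
    assume "\<exists>r>0. \<rho> = ereal r \<and> local_hessian_smooth r M0 M1 f"
    then obtain r where "\<rho> = ereal r" "local_hessian_smooth r M0 M1 f" by blast
    with that show ?thesis
      unfolding local_hessian_smooth_def by (simp only: ereal_less_eq(3))
  qed
  have rho: "\<rho> > 0"
    using assms(15) by (elim disjE exE conjE) simp_all
  interpret N: adaptive_newton f \<mu> H xstar x0 M0 M1 \<nu> \<eta>0 \<rho>
  proof
    show "opnorm (hess f v - hess f u) \<le> (M0 + M1 * norm (grad f u)) * norm (v - u)"
      if "ereal (norm (v - u)) \<le> \<rho>" for u v
      using that by (rule smooth)
    show "transpose (H z) = H z" for z
      using assms(16) by blast
    show "opnorm (H (arn_x f H x0 \<eta>0 k) - hess f (arn_x f H x0 \<eta>0 k))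
        \<le> \<nu> * norm (grad f (arn_x f H x0 \<eta>0 k))" if "arn_reached f H x0 \<eta>0 k" for k
      using assms(17) that unfolding x_def reached_def by blast
  qed (fact assms(7-14) rho)+
  note defs = x_def \<tau>_def reached_def completed_def r0_def C_def
  have dichotomy: "(\<exists>k. reached k \<and> grad f (x k) = 0) \<or> (\<forall>k. completed k)"
    unfolding defs by (rule N.finite_termination_or_completed)
  have superlinear: "(\<lambda>k. (f (x (Suc k)) - f xstar) / (f (x k) - f xstar)) \<longlonglongrightarrow> 0"
    if "\<forall>k. completed k"
    using that unfolding x_def completed_def by (intro N.superlinear) (rule spec)
  have tau: "ereal (\<tau> k) \<le>
          max (ereal ((1 / 2) ^ k * \<eta>0 / norm (grad f x0)))
            (max (ereal (24 * M0 / \<mu> + 8 * \<nu>)) (2 / r0)) * ereal (norm (grad f (x k)))"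
    if "completed k" for k
    using that
    unfolding defs N.ereal_alpha[symmetric] N.\<beta>_def[symmetric]
      ereal_max[symmetric] times_ereal.simps ereal_less_eq(3)
    by (rule N.tau_le)
  have decrease: "f (x (Suc k)) - f xstar \<le>
          (1 - 2 * \<mu> / (3 * \<tau> k + 2 * \<mu>))\<^sup>2 * (f (x k) - f xstar)"
    if "completed k" for k
    using that unfolding defs by (rule N.gap_decrease)
  have quadratic: "\<exists>K\<ge>K0. \<forall>k\<ge>K. completed k \<longrightarrow>
           f (x (Suc k)) - f xstar \<le> C * (f (x k) - f xstar)\<^sup>2" for K0
  proof (cases "\<forall>k. completed k")
    case True
    have C: "C = 9 * (opnorm (hess f xstar) + \<mu>) / (2 * \<mu>\<^sup>2) * N.\<beta>\<^sup>2"
      unfolding C_def N.\<beta>_def by (simp only: add.commute)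
    have "\<forall>\<^sub>F k in sequentially. f (x (Suc k)) - f xstar \<le> C * (f (x k) - f xstar)\<^sup>2"
      using True unfolding C x_def completed_def by (intro N.eventually_quadratic) (rule spec)
    then obtain K where "\<forall>k\<ge>K. f (x (Suc k)) - f xstar \<le> C * (f (x k) - f xstar)\<^sup>2"
      unfolding eventually_sequentially by blast
    then show ?thesis
      by (intro exI[of _ "max K K0"]) simp
  next
    case False
    then obtain k where k: "reached k" "grad f (x k) = 0"
      using dichotomy by blast
    \<comment> \<open>Nothing is completed after the stop, so the claim about \<open>k \<ge> K\<close> is void for large \<open>K\<close>.\<close>
    have "\<not> completed j" if "j \<ge> k" for j
    proof
      assume "completed j"
      then have "completed k"
        using arn_reached_mono[of f H x0 \<eta>0 "Suc j" "Suc k"] that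
        unfolding completed_def arn_completed_def by simp
      with k(2) show False
        using arn_completedD(2) unfolding x_def completed_def by blast
    qed
    then show ?thesis
      by (intro exI[of _ "max k K0"]) simp
  qed
  have minimal: "f (x k) \<le> f y" if "grad f (x k) = 0" for k y
    using that by (rule N.minimizer_of_grad_zero)
  show ?thesis
  proof (intro conjI allI impI)
    show "(\<exists>k. reached k \<and> grad f (x k) = 0 \<and> (\<forall>y. f (x k) \<le> f y)) \<or>
      ((\<forall>k. completed k) \<and>
       (\<lambda>k. (f (x (Suc k)) - f xstar) / (f (x k) - f xstar)) \<longlonglongrightarrow> 0)"
      using dichotomy superlinear minimal by blast
  qed (erule tau, erule decrease, rule quadratic)
qed

end
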